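(* For every $m,n,r\in\mathbb{N}$ the total number $s(m,n,r)$ of subgroups of the group $\mathbb{Z}_m\times\mathbb{Z}_n\times\mathbb{Z}_r$ is given by $$s(m,n,r)=\sum_{a\mid m,\ b\mid n,\ c\mid r}\frac{ABC}{X^2}\,P(X),$$ where, for each triple $(a,b,c)$ of positive divisors $a\mid m$, $b\mid n$, $c\mid r$, $$A=\gcd(a,n/b),\quad B=\gcd(b,r/c),\quad C=\gcd(a,r/c),\quad X=\frac{ABC}{\gcd(a(r/c),\,ABC)}.$$ Moreover, for every $\delta\in\mathbb{N}$ with $\delta\mid mnr$, the number of subgroups of order $\delta$ of $\mathbb{Z}_m\times\mathbb{Z}_n\times\mathbb{Z}_r$ is given by the same sum restricted to those triples $(a,b,c)$ with $a\mid m$, $b\mid n$, $c\mid r$ and $abc=mnr/\delta$.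
   Context: $\mathbb{N}=\{1,2,\ldots\}$, and $\mathbb{Z}_m$ is the additive group of residue classes modulo $m$. $P$ is the gcd-sum function $P(n):=\sum_{k=1}^n\gcd(k,n)=\sum_{d\mid n}d\,\phi(n/d)$ for $n\in\mathbb{N}$, where $\phi$ is Euler's totient function. *)

theory Defs
  imports
    Complex_Main
    "HOL-Algebra.Elementary_Groups"
begin

definition gcd_sum :: "nat \<Rightarrow> nat" where
  "gcd_sum n = (\<Sum>k = 1..n. gcd k n)"

abbreviation Z3 :: "nat \<Rightarrow> nat \<Rightarrow> nat \<Rightarrow> (int \<times> int \<times> int) monoid" where
  "Z3 m n r \<equiv> integer_mod_group m \<times>\<times> integer_mod_group n \<times>\<times> integer_mod_group r"

definition num_subgroups :: "nat \<Rightarrow> nat \<Rightarrow> nat \<Rightarrow> nat" where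
  "num_subgroups m n r = card {H. subgroup H (Z3 m n r)}"

definition num_subgroups_of_order :: "nat \<Rightarrow> nat \<Rightarrow> nat \<Rightarrow> nat \<Rightarrow> nat" where
  "num_subgroups_of_order m n r \<delta> = card {H. subgroup H (Z3 m n r) \<and> card H = \<delta>}"

(* For b dvd n and c dvd r, with a, b, c, n, r positive, every "div" below is an exact
   division. The quotient by X^2 is taken in the rationals, so its integrality is not
   presupposed. *)
definition summand :: "nat \<Rightarrow> nat \<Rightarrow> nat \<Rightarrow> nat \<Rightarrow> nat \<Rightarrow> rat" where
  "summand n r a b c =
     (let A = gcd a (n div b);
          B = gcd b (r div c);
          C = gcd a (r div c);
          X = (A * B * C) div gcd (a * (r div c)) (A * B * C)
      in of_nat (A * B * C) / (of_nat X)\<^sup>2 * of_nat (gcd_sum X))"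

end

theory Submission
  imports Defs "HOL-Library.Product_Plus"
begin

text \<open>
Subgroups of $\mathbb{Z}_m \times \mathbb{Z}_n \times \mathbb{Z}_r$ are the same thing as
subgroups of $\mathbb{Z}^3$ that contain $(m,0,0)$, $(0,n,0)$ and $(0,0,r)$: take the preimage
under reduction in one direction, intersect with the box of canonical representatives in the
other (\<open>bij_betw_lattices_subgroups\<close>). Each such lattice has exactly one basis in Hermite normal
form
\[ (a, 0, 0), \quad (s, b, 0), \quad (u, v, c), \qquad
   a, b, c > 0, \quad 0 \le s, u < a, \quad 0 \le v < b, \]
and the three required vectors belong to the lattice spanned by such a basis if and only if
$a \mid m$, $b \mid n$, $c \mid r$ and
\[ a \mid \frac{n}{b} s, \qquad b \mid \frac{r}{c} v, \qquad
   a \mid \frac{r}{c} u - \frac{(r/c) v}{b} s \]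
(\<open>bij_betw_hnf_lattices\<close>).

It remains to count the triples $(s, u, v)$ for given $(a, b, c)$ (\<open>card_hnf_entries\<close>). The first
two conditions say $s = (a/A) t$ and $v = (b/B) w$ with $0 \le t < A$ and $0 \le w < B$. The third
is then a linear congruence for $u$ modulo $a$ with coefficient $r/c$; it has $C$ solutions or
none, and it is solvable exactly when $C$ divides $\frac{r/c}{B} w \cdot \frac{a}{A} t$, that is,
when $ABC$ divides $a (r/c) t w$, that is, when $X \mid t w$. Since $X$ divides both $A$ and $B$, the
pairs $(t, w)$ with $X \mid t w$ can be counted modulo $X$, where each $t$ admits $\gcd(t, X)$ values
of $w$; so there are $(A/X) (B/X) P(X)$ of them. Multiplying by $C$ gives the summand.

The lattice has index $abc$ in $\mathbb{Z}^3$, so the subgroup has order $mnr/(abc)$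
(\<open>card_hnf_lattice_box\<close>); restricting the order of the subgroup therefore restricts the sum to the
triples with the corresponding product $abc$.
\<close>

section \<open>Additive subgroups of the integers and of integer triples\<close>

definition diff_closed :: "'a::ab_group_add set \<Rightarrow> bool" where
  "diff_closed L \<longleftrightarrow> (\<forall>p\<in>L. \<forall>q\<in>L. p - q \<in> L)"

lemma diff_closedD: "diff_closed L \<Longrightarrow> p \<in> L \<Longrightarrow> q \<in> L \<Longrightarrow> p - q \<in> L"
  by (auto simp: diff_closed_def)

lemma diff_closed_zero: "diff_closed L \<Longrightarrow> p \<in> L \<Longrightarrow> 0 \<in> L"
  using diff_closedD[of L p p] by simp

lemma diff_closed_add: "diff_closed L \<Longrightarrow> p \<in> L \<Longrightarrow> q \<in> L \<Longrightarrow> p + q \<in> L"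
  using diff_closedD[of L p "0 - q"] diff_closedD[of L 0 q] diff_closed_zero[of L p] by simp

text \<open>
A sequence that starts at zero and has constant increments \<open>p \<in> L\<close> stays in \<open>L\<close>. This makes scalar multiplication by
integers available both on \<^typ>\<open>int\<close> and on \<^typ>\<open>int \<times> int \<times> int\<close>, where it is written as
different terms.
\<close>

lemma diff_closed_steps:
  fixes f :: "int \<Rightarrow> 'a::ab_group_add"
  assumes L: "diff_closed L" and f0: "f 0 = 0" and p: "p \<in> L"
    and step: "\<And>k. f (k + 1) = f k + p"
  shows "f k \<in> L"
proof (induction k rule: int_induct[where k = 0])
  case base
  show ?case using diff_closed_zero[OF L p] f0 by simp
next
  case (step1 i)
  then show ?case using diff_closed_add[OF L _ p] step by simp
next
  case (step2 i)
  then show ?case using diff_closedD[OF L _ p] step[of "i - 1"] by (metis add_diff_cancel diff_add_cancel)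
qed

lemma diff_closed_mult:
  assumes "diff_closed P" "x \<in> P"
  shows "k * x \<in> (P :: int set)"
  by (rule diff_closed_steps[where f = "\<lambda>k. k * x", OF assms(1) _ assms(2)])
     (auto simp: algebra_simps)

lemma diff_closed_mult3:
  fixes x y z :: int
  assumes "diff_closed L" "(x, y, z) \<in> L"
  shows "(k * x, k * y, k * z) \<in> L"
  by (rule diff_closed_steps[where f = "\<lambda>k. (k * x, k * y, k * z)", OF assms(1) _ assms(2)])
     (auto simp: algebra_simps zero_prod_def)

text \<open>
The generator is the least positive element: remainders modulo it stay in the set, so they vanish.
The given positive element excludes the zero subgroup.
\<close>

lemma diff_closed_int_generator:
  fixes P :: "int set"
  assumes P: "diff_closed P" and N: "int N \<in> P" "N > 0"
  obtains d where "d > 0" "P = {x. int d dvd x}"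
proof -
  define d where "d = (LEAST d. d > 0 \<and> int d \<in> P)"
  have d: "d > 0 \<and> int d \<in> P"
    unfolding d_def by (rule LeastI[of _ N]) (use N in auto)
  have least: "d \<le> e" if "e > 0" "int e \<in> P" for e
    unfolding d_def by (rule Least_le) (use that in auto)
  have "int d dvd x" if x: "x \<in> P" for x
  proof -
    have "x - (x div int d) * int d \<in> P"
      using diff_closedD[OF P x] diff_closed_mult[OF P] d by blast
    then have mod: "x mod int d \<in> P"
      by (simp add: minus_div_mult_eq_mod)
    have "x mod int d \<ge> 0" "x mod int d < int d" using d by auto
    moreover have "d \<le> nat (x mod int d)" if "x mod int d > 0"
      using least[of "nat (x mod int d)"] mod that by simp
    ultimately have "x mod int d = 0" by linarith
    then show ?thesis by presburger
  qed
  moreover have "x \<in> P" if "int d dvd x" for x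
    using that diff_closed_mult[OF P conjunct2[OF d]] by (auto elim!: dvdE simp: mult.commute)
  ultimately show ?thesis using that d by blast
qed

section \<open>Hermite normal form of a lattice\<close>

definition lattices :: "nat \<Rightarrow> nat \<Rightarrow> nat \<Rightarrow> (int \<times> int \<times> int) set set" where
  "lattices m n r = {L. diff_closed L \<and> (int m, 0, 0) \<in> L \<and> (0, int n, 0) \<in> L \<and> (0, 0, int r) \<in> L}"

text \<open>
The integer span of the rows $(a,0,0)$, $(s,b,0)$, $(u,v,c)$. The diagonal entries are kept as a
separate component, since the final sum runs over them.
\<close>

definition hnf_lattice :: "(nat \<times> nat \<times> nat) \<times> (int \<times> int \<times> int) \<Rightarrow> (int \<times> int \<times> int) set" where
  "hnf_lattice = (\<lambda>((a, b, c), (s, u, v)).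
     {(x, y, z). \<exists>i j k. x = i * int a + j * s + k * u \<and> y = j * int b + k * v \<and> z = k * int c})"

text \<open>
For $b \mid n$ and $c \mid r$: the off-diagonal entries that are reduced and for which the span contains $(0,n,0)$ and $(0,0,r)$.
\<close>

definition hnf_entries :: "nat \<Rightarrow> nat \<Rightarrow> nat \<times> nat \<times> nat \<Rightarrow> (int \<times> int \<times> int) set" where
  "hnf_entries n r = (\<lambda>(a, b, c). {(s, u, v).
      s \<in> {0..<int a} \<and> u \<in> {0..<int a} \<and> v \<in> {0..<int b} \<and>
      int a dvd int (n div b) * s \<and> int b dvd int (r div c) * v \<and>
      int a dvd int (r div c) * u - (int (r div c) * v div int b) * s})"

definition divisor_triples :: "nat \<Rightarrow> nat \<Rightarrow> nat \<Rightarrow> (nat \<times> nat \<times> nat) set" where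
  "divisor_triples m n r = {(a, b, c). a dvd m \<and> b dvd n \<and> c dvd r}"

text \<open>
Back substitution: the coefficients of the basis vectors are forced, from the last coordinate
to the first.
\<close>

lemma hnf_lattice_iff:
  assumes "a > 0" "b > 0" "c > 0"
  shows "(x, y, z) \<in> hnf_lattice ((a, b, c), (s, u, v)) \<longleftrightarrow>
    int c dvd z \<and> int b dvd y - (z div int c) * v \<and>
    int a dvd x - (z div int c) * u - ((y - (z div int c) * v) div int b) * s"
    (is "?l \<longleftrightarrow> ?r")
proof
  assume ?l
  then obtain i j k where "x = i * int a + j * s + k * u" "y = j * int b + k * v" "z = k * int c"
    by (auto simp: hnf_lattice_def)
  then show ?r using assms by simp
next
  assume r: ?r
  define k where "k = z div int c"
  define j where "j = (y - k * v) div int b"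
  have k: "z = k * int c" and j: "y - k * v = j * int b" using r by (auto simp: k_def j_def)
  from r obtain i where "x - k * u - j * s = i * int a"
    unfolding k_def j_def by (metis dvdE mult.commute)
  then have "x = i * int a + j * s + k * u \<and> y = j * int b + k * v \<and> z = k * int c"
    using k j by (simp add: algebra_simps)
  then show ?l by (auto simp: hnf_lattice_def)
qed

lemma diff_closed_hnf_lattice: "diff_closed (hnf_lattice t)"
proof -
  obtain a b c s u v where t: "t = ((a, b, c), (s, u, v))" by (metis prod_cases3 surj_pair)
  have "\<exists>i j k. x - x' = i * int a + j * s + k * u \<and> y - y' = j * int b + k * v \<and> z - z' = k * int c"
    if "x = i * int a + j * s + k * u" "y = j * int b + k * v" "z = k * int c"
       "x' = i' * int a + j' * s + k' * u" "y' = j' * int b + k' * v" "z' = k' * int c"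
    for x y z x' y' z' i j k i' j' k'
    by (rule exI[of _ "i - i'"], rule exI[of _ "j - j'"], rule exI[of _ "k - k'"])
       (simp add: that algebra_simps)
  then show ?thesis unfolding diff_closed_def t hnf_lattice_def by auto
qed

lemma hnf_lattice_in_lattices_iff:
  assumes "a > 0" "b > 0" "c > 0"
    and "s \<in> {0..<int a}" "u \<in> {0..<int a}" "v \<in> {0..<int b}"
  shows "hnf_lattice ((a, b, c), (s, u, v)) \<in> lattices m n r \<longleftrightarrow>
    (a, b, c) \<in> divisor_triples m n r \<and> (s, u, v) \<in> hnf_entries n r (a, b, c)"
proof -
  let ?L = "hnf_lattice ((a, b, c), (s, u, v))"
  have m: "(int m, 0, 0) \<in> ?L \<longleftrightarrow> a dvd m"
    using assms by (simp add: hnf_lattice_iff)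
  have n: "(0, int n, 0) \<in> ?L \<longleftrightarrow> b dvd n \<and> int a dvd int (n div b) * s"
    using assms by (simp add: hnf_lattice_iff zdiv_int)
  have r: "(0, 0, int r) \<in> ?L \<longleftrightarrow> c dvd r \<and> int b dvd int (r div c) * v \<and>
      int a dvd int (r div c) * u - (int (r div c) * v div int b) * s"
  proof (cases "c dvd r \<and> int b dvd int (r div c) * v")
    case True
    then have "(0 - int (r div c) * v) div int b = - (int (r div c) * v div int b)"
      by (simp add: dvd_neg_div)
    then have "0 - int (r div c) * u - ((0 - int (r div c) * v) div int b) * s
        = - (int (r div c) * u - (int (r div c) * v div int b) * s)"
      by (simp only: algebra_simps mult_minus_left)
    then have "int a dvd 0 - int (r div c) * u - ((0 - int (r div c) * v) div int b) * s \<longleftrightarrow>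
      int a dvd int (r div c) * u - (int (r div c) * v div int b) * s"
      by (simp only: dvd_minus_iff)
    then show ?thesis using assms True by (simp add: hnf_lattice_iff zdiv_int)
  next
    case False
    then show ?thesis using assms by (auto simp: hnf_lattice_iff zdiv_int)
  qed
  show ?thesis
    using assms m n r diff_closed_hnf_lattice
    by (auto simp: lattices_def divisor_triples_def hnf_entries_def)
qed

text \<open>
The diagonal entry \<open>c\<close> generates the projection of \<open>L\<close> to the last coordinate, \<open>b\<close> the projection
to the second coordinate of the vectors with last coordinate zero, and \<open>a\<close> the multiples of the
first unit vector in \<open>L\<close>. Preimages of these generators form a basis, whose off-diagonal entries
can be reduced by subtracting multiples of the earlier rows.
\<close>

lemma lattice_has_hnf:
  assumes L: "L \<in> lattices m n r" and pos: "m > 0" "n > 0" "r > 0"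
  obtains a b c s u v where "a > 0" "b > 0" "c > 0"
    "s \<in> {0..<int a}" "u \<in> {0..<int a}" "v \<in> {0..<int b}"
    "L = hnf_lattice ((a, b, c), (s, u, v))"
proof -
  have dc: "diff_closed L" and inL: "(int m, 0, 0) \<in> L" "(0, int n, 0) \<in> L" "(0, 0, int r) \<in> L"
    using L by (auto simp: lattices_def)
  \<comment> \<open>Generators of the three subgroups of the integers cut out by the coordinate flag.\<close>
  have "diff_closed {z. \<exists>x y. (x, y, z) \<in> L}"
    unfolding diff_closed_def using diff_closedD[OF dc] by fastforce
  then obtain c where c: "c > 0" "{z. \<exists>x y. (x, y, z) \<in> L} = {z. int c dvd z}"
    using inL pos by (elim diff_closed_int_generator[of _ r]) auto
  have "diff_closed {y. \<exists>x. (x, y, 0) \<in> L}"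
    unfolding diff_closed_def using diff_closedD[OF dc] by fastforce
  then obtain b where b: "b > 0" "{y. \<exists>x. (x, y, 0) \<in> L} = {y. int b dvd y}"
    using inL pos by (elim diff_closed_int_generator[of _ n]) auto
  have "diff_closed {x. (x, 0, 0) \<in> L}"
    unfolding diff_closed_def using diff_closedD[OF dc] by fastforce
  then obtain a where a: "a > 0" "{x. (x, 0, 0) \<in> L} = {x. int a dvd x}"
    using inL pos by (elim diff_closed_int_generator[of _ m]) auto
  have a_iff: "(x, 0, 0) \<in> L \<longleftrightarrow> int a dvd x" for x
    using a(2) by (auto simp: set_eq_iff)
  have b_iff: "(\<exists>x. (x, y, 0) \<in> L) \<longleftrightarrow> int b dvd y" for y
    using b(2) by (auto simp: set_eq_iff)
  have c_iff: "(\<exists>x y. (x, y, z) \<in> L) \<longleftrightarrow> int c dvd z" for z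
    using c(2) by (auto simp: set_eq_iff)
  have aL: "(int a, 0, 0) \<in> L" using a_iff by simp
  obtain s0 where s0: "(s0, int b, 0) \<in> L" using b_iff[of "int b"] by auto
  obtain u0 v0 where uv0: "(u0, v0, int c) \<in> L" using c_iff[of "int c"] by auto
  \<comment> \<open>Reducing \<open>v0\<close> modulo \<open>b\<close> changes the first entry of the row, so that entry is reduced last.\<close>
  define s where "s = s0 mod int a"
  have sL: "(s, int b, 0) \<in> L"
    using diff_closedD[OF dc s0 diff_closed_mult3[OF dc aL, of "s0 div int a"]]
    by (simp add: s_def minus_div_mult_eq_mod)
  define v where "v = v0 mod int b"
  define u1 where "u1 = u0 - (v0 div int b) * s"
  have u1: "(u1, v, int c) \<in> L"
    using diff_closedD[OF dc uv0 diff_closed_mult3[OF dc sL, of "v0 div int b"]]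
    by (simp add: u1_def v_def minus_div_mult_eq_mod)
  define u where "u = u1 mod int a"
  have uL: "(u, v, int c) \<in> L"
    using diff_closedD[OF dc u1 diff_closed_mult3[OF dc aL, of "u1 div int a"]]
    by (simp add: u_def minus_div_mult_eq_mod)
  have "(x, y, z) \<in> L \<longleftrightarrow> (x, y, z) \<in> hnf_lattice ((a, b, c), (s, u, v))" for x y z
  proof
    assume xyz: "(x, y, z) \<in> L"
    then have "int c dvd z" using c_iff[of z] by blast
    then obtain k where k: "z = k * int c" by (metis dvdE mult.commute)
    have 1: "(x - k * u, y - k * v, 0) \<in> L"
      using diff_closedD[OF dc xyz diff_closed_mult3[OF dc uL, of k]] k by simp
    then have "int b dvd y - k * v" using b_iff[of "y - k * v"] by blast
    then obtain j where j: "y - k * v = j * int b" by (metis dvdE mult.commute)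
    have "(x - k * u - j * s, 0, 0) \<in> L"
      using diff_closedD[OF dc 1 diff_closed_mult3[OF dc sL, of j]]
      unfolding diff_Pair by (simp only: j diff_self mult_zero_right)
    then have "int a dvd x - k * u - j * s" using a_iff by simp
    then obtain i where "x - k * u - j * s = i * int a" by (metis dvdE mult.commute)
    then have "x = i * int a + j * s + k * u \<and> y = j * int b + k * v \<and> z = k * int c"
      using j k by (simp add: algebra_simps)
    then show "(x, y, z) \<in> hnf_lattice ((a, b, c), (s, u, v))"
      by (auto simp: hnf_lattice_def)
  next
    assume "(x, y, z) \<in> hnf_lattice ((a, b, c), (s, u, v))"
    then obtain i j k where
      "x = i * int a + j * s + k * u" "y = j * int b + k * v" "z = k * int c"
      by (auto simp: hnf_lattice_def)
    then show "(x, y, z) \<in> L"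
      using diff_closed_add[OF dc diff_closed_add[OF dc diff_closed_mult3[OF dc aL, of i]
            diff_closed_mult3[OF dc sL, of j]] diff_closed_mult3[OF dc uL, of k]] by simp
  qed
  then have "L = hnf_lattice ((a, b, c), (s, u, v))" by auto
  moreover have "s \<in> {0..<int a}" "u \<in> {0..<int a}" "v \<in> {0..<int b}"
    using a(1) b(1) by (auto simp: s_def u_def v_def)
  ultimately show ?thesis using that a(1) b(1) c(1) by blast
qed

lemma residue_unique:
  fixes x y i d :: int
  assumes "x \<in> {0..<d}" "y \<in> {0..<d}" "x = i * d + y"
  shows "x = y" "i = 0"
proof -
  have "x = y" using assms by (metis atLeastLessThan_iff mod_mult_self3 mod_pos_pos_trivial)
  then show "x = y" "i = 0" using assms by auto
qed

text \<open>
Each basis vector of one lattice lies in the other, so the diagonal entries divide each other and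
coincide; then the off-diagonal entries are congruent and, being reduced, equal.
\<close>

lemma hnf_unique:
  assumes "a > 0" "b > 0" "c > 0"
    and "s \<in> {0..<int a}" "u \<in> {0..<int a}" "v \<in> {0..<int b}"
    and "a' > 0" "b' > 0" "c' > 0"
    and "s' \<in> {0..<int a'}" "u' \<in> {0..<int a'}" "v' \<in> {0..<int b'}"
    and eq: "hnf_lattice ((a, b, c), (s, u, v)) = hnf_lattice ((a', b', c'), (s', u', v'))"
  shows "a = a' \<and> b = b' \<and> c = c' \<and> s = s' \<and> u = u' \<and> v = v'"
proof -
  have gens: "(int a, 0, 0) \<in> hnf_lattice ((a, b, c), (s, u, v))"
      "(s, int b, 0) \<in> hnf_lattice ((a, b, c), (s, u, v))"
      "(u, v, int c) \<in> hnf_lattice ((a, b, c), (s, u, v))"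
    if "a > 0" "b > 0" "c > 0" for a b c s u v
    using that by (auto simp: hnf_lattice_iff)
  note g = gens[OF assms(1-3), where s = s and u = u and v = v, unfolded eq hnf_lattice_iff[OF assms(7-9)]]
  note g' = gens[OF assms(7-9), where s = s' and u = u' and v = v', folded eq, unfolded hnf_lattice_iff[OF assms(1-3)]]
  have c: "c = c'" using g g' by (auto intro: dvd_antisym)
  have b: "b = b'" using g g' by (auto intro: dvd_antisym)
  have a: "a = a'" using g g' by (auto intro: dvd_antisym)
  have "int a dvd s - s'" using g(2) assms a b c by auto
  then obtain i where "s = i * int a + s'" by (metis dvdE mult.commute diff_add_cancel)
  then have s: "s = s'" using residue_unique(1) assms a by blast
  have "int b dvd v - v'" using g(3) assms a b c by auto
  then obtain j where "v = j * int b + v'" by (metis dvdE mult.commute diff_add_cancel)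
  then have v: "v = v'" using residue_unique(1) assms b by blast
  have "int a dvd u - u'" using g(3) assms a b c v by auto
  then obtain k where "u = k * int a + u'" by (metis dvdE mult.commute diff_add_cancel)
  then have "u = u'" using residue_unique(1) assms a by blast
  with a b c s v show ?thesis by blast
qed

lemma bij_betw_hnf_lattices:
  assumes pos: "m > 0" "n > 0" "r > 0"
  shows "bij_betw hnf_lattice (Sigma (divisor_triples m n r) (hnf_entries n r)) (lattices m n r)"
proof -
  have range: "a > 0 \<and> b > 0 \<and> c > 0 \<and> s \<in> {0..<int a} \<and> u \<in> {0..<int a} \<and> v \<in> {0..<int b}"
    if "((a, b, c), (s, u, v)) \<in> Sigma (divisor_triples m n r) (hnf_entries n r)" for a b c s u v
    using that pos by (auto simp: divisor_triples_def hnf_entries_def intro: dvd_pos_nat)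
  show ?thesis
    unfolding bij_betw_def
  proof (intro conjI inj_onI subset_antisym subsetI)
    fix t t'
    assume "t \<in> Sigma (divisor_triples m n r) (hnf_entries n r)"
      "t' \<in> Sigma (divisor_triples m n r) (hnf_entries n r)" "hnf_lattice t = hnf_lattice t'"
    moreover obtain a b c s u v where t: "t = ((a, b, c), (s, u, v))" by (metis prod_cases3 surj_pair)
    moreover obtain a' b' c' s' u' v' where t': "t' = ((a', b', c'), (s', u', v'))"
      by (metis prod_cases3 surj_pair)
    ultimately show "t = t'"
      using range[of a b c s u v] range[of a' b' c' s' u' v']
        hnf_unique[of a b c s u v a' b' c' s' u' v'] by simp
  next
    fix L assume "L \<in> hnf_lattice ` Sigma (divisor_triples m n r) (hnf_entries n r)"
    then show "L \<in> lattices m n r"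
      using range hnf_lattice_in_lattices_iff by fastforce
  next
    fix L assume L: "L \<in> lattices m n r"
    from lattice_has_hnf[OF L pos] obtain a b c s u v where *: "a > 0" "b > 0" "c > 0"
      "s \<in> {0..<int a}" "u \<in> {0..<int a}" "v \<in> {0..<int b}" "L = hnf_lattice ((a, b, c), (s, u, v))"
      by metis
    then have "(a, b, c) \<in> divisor_triples m n r \<and> (s, u, v) \<in> hnf_entries n r (a, b, c)"
      using L hnf_lattice_in_lattices_iff[OF *(1-6)] by blast
    then show "L \<in> hnf_lattice ` Sigma (divisor_triples m n r) (hnf_entries n r)"
      using *(7) by blast
  qed
qed

section \<open>Subgroups of a product of three cyclic groups as lattices\<close>

definition reduce3 :: "nat \<Rightarrow> nat \<Rightarrow> nat \<Rightarrow> int \<times> int \<times> int \<Rightarrow> int \<times> int \<times> int" where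
  "reduce3 m n r = (\<lambda>(x, y, z). (x mod int m, y mod int n, z mod int r))"

lemma carrier_Z3:
  assumes "m > 0" "n > 0" "r > 0"
  shows "carrier (Z3 m n r) = {0..<int m} \<times> {0..<int n} \<times> {0..<int r}"
  using assms by (simp add: carrier_integer_mod_group)

lemma group_Z3: "group (Z3 m n r)"
  by (intro DirProd_group group_integer_mod_group)

lemma mult_Z3: "p \<otimes>\<^bsub>Z3 m n r\<^esub> q = reduce3 m n r (p + q)"
  by (cases p; cases q) (auto simp: reduce3_def)

lemma inv_Z3:
  assumes "p \<in> carrier (Z3 m n r)"
  shows "inv\<^bsub>Z3 m n r\<^esub> p = reduce3 m n r (- p)"
  using assms by (cases p) (auto simp: reduce3_def DirProd_group)

lemma reduce3_carrier:
  assumes "m > 0" "n > 0" "r > 0"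
  shows "reduce3 m n r p \<in> carrier (Z3 m n r)"
  unfolding carrier_Z3[OF assms] using assms by (auto simp: reduce3_def split: prod.split)

lemma reduce3_id:
  assumes "m > 0" "n > 0" "r > 0" "p \<in> carrier (Z3 m n r)"
  shows "reduce3 m n r p = p"
  using assms(4) unfolding carrier_Z3[OF assms(1-3)] by (auto simp: reduce3_def)

text \<open>
Reduction subtracts an integer combination of $(m,0,0)$, $(0,n,0)$ and $(0,0,r)$, all of which lie
in \<open>L\<close>.
\<close>

lemma reduce3_in_lattice_iff:
  assumes L: "L \<in> lattices m n r"
  shows "reduce3 m n r p \<in> L \<longleftrightarrow> p \<in> L"
proof -
  have dc: "diff_closed L" using L by (simp add: lattices_def)
  obtain x y z where p: "p = (x, y, z)" by (cases p)
  define q where "q = (x div int m * int m, y div int n * int n, z div int r * int r)"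
  have "(x div int m * int m, x div int m * 0, x div int m * 0)
      + (y div int n * 0, y div int n * int n, y div int n * 0)
      + (z div int r * 0, z div int r * 0, z div int r * int r) \<in> L"
    using L by (intro diff_closed_add[OF dc] diff_closed_mult3[OF dc]) (auto simp: lattices_def)
  then have q: "q \<in> L" by (simp add: q_def)
  have eq: "reduce3 m n r p = p - q"
    by (simp add: p q_def reduce3_def minus_div_mult_eq_mod)
  show ?thesis
    unfolding eq using diff_closedD[OF dc _ q, of p] diff_closed_add[OF dc _ q, of "p - q"] by auto
qed

lemma lattice_imp_subgroup:
  assumes L: "L \<in> lattices m n r" and pos: "m > 0" "n > 0" "r > 0"
  shows "subgroup (L \<inter> carrier (Z3 m n r)) (Z3 m n r)"
proof -
  have dc: "diff_closed L" and ne: "(int m, 0, 0) \<in> L" using L by (auto simp: lattices_def)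
  note zero = diff_closed_zero[OF dc ne]
  show ?thesis
  proof (rule group.subgroupI[OF group_Z3])
    have "(0, 0, 0) \<in> L \<inter> carrier (Z3 m n r)"
      using zero pos by (simp add: carrier_Z3 zero_prod_def)
    then show "L \<inter> carrier (Z3 m n r) \<noteq> {}" by blast
  next
    fix p assume p: "p \<in> L \<inter> carrier (Z3 m n r)"
    then have "- p \<in> L" using diff_closedD[OF dc zero, of p] by simp
    then show "inv\<^bsub>Z3 m n r\<^esub> p \<in> L \<inter> carrier (Z3 m n r)"
      using p reduce3_carrier[OF pos] reduce3_in_lattice_iff[OF L] by (simp add: inv_Z3)
  next
    fix p q assume "p \<in> L \<inter> carrier (Z3 m n r)" "q \<in> L \<inter> carrier (Z3 m n r)"
    then have "p + q \<in> L" using diff_closed_add[OF dc] by blast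
    then show "p \<otimes>\<^bsub>Z3 m n r\<^esub> q \<in> L \<inter> carrier (Z3 m n r)"
      using reduce3_carrier[OF pos] reduce3_in_lattice_iff[OF L] by (simp only: mult_Z3 Int_iff) 
  qed blast
qed

lemma subgroup_imp_lattice:
  assumes H: "subgroup H (Z3 m n r)" and pos: "m > 0" "n > 0" "r > 0"
  shows "{p. reduce3 m n r p \<in> H} \<in> lattices m n r"
proof -
  have "(0, 0, 0) \<in> H" using subgroup.one_closed[OF H] by simp
  moreover have "reduce3 m n r (p - q) \<in> H"
    if p: "reduce3 m n r p \<in> H" and q: "reduce3 m n r q \<in> H" for p q
  proof -
    have "reduce3 m n r (reduce3 m n r p + reduce3 m n r (- reduce3 m n r q)) \<in> H"
      using subgroup.m_closed[OF H p subgroup.m_inv_closed[OF H q]]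
        inv_Z3[OF reduce3_carrier[OF pos]] by (simp only: mult_Z3)
    also have "reduce3 m n r (reduce3 m n r p + reduce3 m n r (- reduce3 m n r q))
        = reduce3 m n r (p - q)"
      by (cases p; cases q) (simp add: reduce3_def mod_simps)
    finally show ?thesis .
  qed
  ultimately show ?thesis by (simp add: lattices_def diff_closed_def reduce3_def)
qed

text \<open>
The correspondence theorem for the quotient map $\mathbb{Z}^3 \to \mathbb{Z}_m \times \mathbb{Z}_n
\times \mathbb{Z}_r$. As the residues are represented by integers, the image of a lattice is its
intersection with the carrier.
\<close>

lemma bij_betw_lattices_subgroups:
  assumes pos: "m > 0" "n > 0" "r > 0"
  shows "bij_betw (\<lambda>L. L \<inter> carrier (Z3 m n r)) (lattices m n r) {H. subgroup H (Z3 m n r)}"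
proof (rule bij_betw_byWitness[where f' = "\<lambda>H. {p. reduce3 m n r p \<in> H}"])
  show "\<forall>L\<in>lattices m n r. {p. reduce3 m n r p \<in> L \<inter> carrier (Z3 m n r)} = L"
    using reduce3_carrier[OF pos] reduce3_in_lattice_iff by blast
  show "\<forall>H\<in>{H. subgroup H (Z3 m n r)}. {p. reduce3 m n r p \<in> H} \<inter> carrier (Z3 m n r) = H"
    using reduce3_id[OF pos] subgroup.subset by fastforce
qed (use lattice_imp_subgroup[OF _ pos] subgroup_imp_lattice[OF _ pos] in auto)

section \<open>Counting solutions of congruences\<close>

lemma finite_bounded_ints: "finite {x \<in> {0..<N :: int}. P x}"
  by (rule finite_subset[of _ "{0..<N}"]) auto

text \<open>
After cancelling \<open>gcd q d\<close> from both sides, the cofactor of \<open>q\<close> is coprime to the modulus.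
\<close>

lemma dvd_mult_iff_div_gcd_dvd:
  fixes d q w :: "'a::semiring_gcd"
  assumes "d \<noteq> 0"
  shows "d dvd q * w \<longleftrightarrow> d div gcd q d dvd w"
proof -
  define g where "g = gcd q d"
  have g: "g \<noteq> 0" "g dvd q" "g dvd d" using assms by (auto simp: g_def)
  then obtain q' d' where qd: "q = g * q'" "d = g * d'" by (auto elim!: dvdE)
  have "coprime (q div gcd q d) (d div gcd q d)" using assms by (intro div_gcd_coprime) auto
  then have cop: "coprime q' d'" using qd g unfolding g_def[symmetric] by simp
  have "d dvd q * w \<longleftrightarrow> d' dvd q' * w" using g(1) unfolding qd by (simp add: mult.assoc)
  also have "\<dots> \<longleftrightarrow> d' dvd w" using cop by (simp add: coprime_commute coprime_dvd_mult_right_iff)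
  finally show ?thesis unfolding g_def[symmetric] using qd g by simp
qed

text \<open>
An interval of length $kd$ is made of $k$ complete residue systems modulo $d$.
\<close>

lemma card_residue_class:
  assumes "d > 0"
  shows "card {x \<in> {0..<int (k * d)}. int d dvd x - x0} = k"
proof -
  define \<rho> where "\<rho> = x0 mod int d"
  have \<rho>: "0 \<le> \<rho>" "\<rho> < int d" using assms by (auto simp: \<rho>_def)
  have dvd_iff: "int d dvd x - x0 \<longleftrightarrow> x mod int d = \<rho>" for x
    by (simp add: \<rho>_def mod_eq_dvd_iff)
  have "bij_betw (\<lambda>i. \<rho> + int i * int d) {..<k} {x \<in> {0..<int (k * d)}. int d dvd x - x0}"
  proof (rule bij_betw_byWitness[where f' = "\<lambda>x. nat (x div int d)"])
    show "\<forall>i\<in>{..<k}. nat ((\<rho> + int i * int d) div int d) = i"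
      using \<rho> by simp
    show "\<forall>x\<in>{x \<in> {0..<int (k * d)}. int d dvd x - x0}. \<rho> + int (nat (x div int d)) * int d = x"
      using assms by (auto simp: dvd_iff pos_imp_zdiv_nonneg_iff)
    show "(\<lambda>i. \<rho> + int i * int d) ` {..<k} \<subseteq> {x \<in> {0..<int (k * d)}. int d dvd x - x0}"
    proof clarify
      fix i assume "i < k"
      then have "(int i + 1) * int d \<le> int k * int d" by (intro mult_right_mono) auto
      then show "\<rho> + int i * int d \<in> {0..<int (k * d)} \<and> int d dvd \<rho> + int i * int d - x0"
        using \<rho> by (simp add: dvd_iff algebra_simps)
    qed
    show "(\<lambda>x. nat (x div int d)) ` {x \<in> {0..<int (k * d)}. int d dvd x - x0} \<subseteq> {..<k}"
    proof (rule image_subsetI)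
      fix x assume "x \<in> {x \<in> {0..<int (k * d)}. int d dvd x - x0}"
      then have x: "x \<in> {0..<int (k * d)}" by blast
      have "(x div int d) * int d \<le> x" using assms by (simp add: minus_mod_eq_div_mult [symmetric])
      also have "\<dots> < int k * int d" using x by simp
      finally have "x div int d < int k" by (rule mult_right_less_imp_less) simp
      then show "nat (x div int d) \<in> {..<k}"
        using x assms by (simp add: nat_less_iff pos_imp_zdiv_nonneg_iff)
    qed
  qed
  then show ?thesis using bij_betw_same_card by fastforce
qed

text \<open>
With $g = \gcd(q, d)$, a Bezout relation provides one solution $x_0$ when $g \mid e$; the
solutions are then the residue class of $x_0$ modulo $d/g$, which meets an interval of length $kd$
in $kg$ points.
\<close>

lemma card_linear_congruence:
  assumes d: "d > 0"
  shows "card {x \<in> {0..<int (k * d)}. int d dvd q * x - e} =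
    (if gcd q (int d) dvd e then k * nat (gcd q (int d)) else 0)"
proof (cases "gcd q (int d) dvd e")
  case True
  define g where "g = nat (gcd q (int d))"
  have g: "int g = gcd q (int d)" "g > 0" using d by (auto simp: g_def)
  have "int g dvd int d" using g by simp
  then obtain d' where d': "d = g * d'" by (auto elim!: dvdE)
  obtain e' where e': "e = int g * e'" using True g by (auto elim!: dvdE)
  obtain \<alpha> \<beta> where bez: "\<alpha> * q + \<beta> * int d = int g" using bezout_int[of q "int d"] g by metis
  define x0 where "x0 = \<alpha> * e'"
  have x0: "q * x0 - e = int d * (- \<beta> * e')"
    unfolding x0_def e' bez[symmetric] by (simp add: algebra_simps)
  have "int d dvd q * x - e \<longleftrightarrow> int d' dvd x - x0" for x
  proof -
    have "q * x - e = q * (x - x0) + int d * (- \<beta> * e')" unfolding x0[symmetric] by (simp add: algebra_simps)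
    then have "int d dvd q * x - e \<longleftrightarrow> int d dvd q * (x - x0)"
      by (metis dvd_add_left_iff dvd_triv_left)
    also have "\<dots> \<longleftrightarrow> int d div gcd q (int d) dvd x - x0"
      using d by (intro dvd_mult_iff_div_gcd_dvd) simp
    also have "int d div gcd q (int d) = int d'" using g d' by (simp flip: g(1))
    finally show ?thesis .
  qed
  moreover have "k * d = (k * g) * d'" "d' > 0" using d d' by auto
  ultimately have "card {x \<in> {0..<int (k * d)}. int d dvd q * x - e} = k * g"
    using card_residue_class[of d' "k * g" x0] by presburger
  then show ?thesis using True by (simp add: g_def)
next
  case False
  have "\<not> int d dvd q * x - e" for x
  proof
    assume "int d dvd q * x - e"
    then have "gcd q (int d) dvd q * x - (q * x - e)"
      by (meson dvd_diff dvd_mult2 dvd_trans gcd_dvd1 gcd_dvd2)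
    then show False using False by simp
  qed
  then show ?thesis using False by simp
qed

text \<open>
The summand has period $X$, and a period starting at $0$ instead of $1$ has the same sum because
$\gcd(0, X) = \gcd(X, X)$.
\<close>

lemma sum_gcd_periods: "(\<Sum>t<k * X. gcd t X) = k * gcd_sum X"
proof -
  have "(\<Sum>t = i * X..<i * X + X. gcd t X) = gcd_sum X" for i
  proof -
    have "(\<Sum>t = i * X..<i * X + X. gcd t X) = (\<Sum>t = 0..<X. gcd (t + i * X) X)"
      using sum.shift_bounds_nat_ivl[of "\<lambda>t. gcd t X" 0 "i * X" X] by (simp add: add.commute)
    also have "\<dots> = (\<Sum>t = 0..<X. gcd t X)"
      by (intro sum.cong refl) (metis gcd_add_mult add.commute gcd.commute mult.commute)
    also have "\<dots> = (\<Sum>t = 1..X. gcd t X)"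
    proof (cases X)
      case (Suc Y)
      have "(\<Sum>t = 0..<X. gcd t X) = X + (\<Sum>t = 1..<X. gcd t X)"
        using sum.atLeast_Suc_lessThan[of 0 X "\<lambda>t. gcd t X"] Suc by simp
      moreover have "(\<Sum>t = 1..X. gcd t X) = X + (\<Sum>t = 1..<X. gcd t X)"
        using sum.last_plus[of 1 X "\<lambda>t. gcd t X"] Suc by simp
      ultimately show ?thesis by simp
    qed simp
    finally show ?thesis by (simp add: gcd_sum_def)
  qed
  then show ?thesis using sum.nat_group[of "\<lambda>t. gcd t X" X k] by simp
qed

text \<open>
For fixed $t$, the condition on $w$ is a homogeneous congruence modulo $X$ on an interval that
consists of $B/X$ periods, with $(B/X) \gcd(t, X)$ solutions; summing over $t$ gives the gcd-sum
function.
\<close>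

lemma card_product_divisible:
  assumes X: "X > 0" "X dvd A" "X dvd B"
  shows "card {(t, w). t \<in> {0..<int A} \<and> w \<in> {0..<int B} \<and> int X dvd t * w} =
    (A div X) * (B div X) * gcd_sum X"
proof -
  have "{(t, w). t \<in> {0..<int A} \<and> w \<in> {0..<int B} \<and> int X dvd t * w}
      = (SIGMA t:{0..<int A}. {w \<in> {0..<int (B div X * X)}. int X dvd t * w - 0})"
    using X by auto
  then have "card {(t, w). t \<in> {0..<int A} \<and> w \<in> {0..<int B} \<and> int X dvd t * w}
      = (\<Sum>t\<in>{0..<int A}. card {w \<in> {0..<int (B div X * X)}. int X dvd t * w - 0})"
    by (simp only: card_SigmaI finite_atLeastLessThan_int finite_bounded_ints ball_triv simp_thms)
  also have "\<dots> = (\<Sum>t\<in>{0..<int A}. (B div X) * nat (gcd t (int X)))"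
    by (intro sum.cong refl) (simp only: card_linear_congruence[OF X(1)] dvd_0_right if_True)
  also have "\<dots> = (\<Sum>t<A. (B div X) * gcd t X)"
    by (rule sum.reindex_bij_witness[of _ int nat]) (auto simp: nat_less_iff gcd_int_def)
  also have "\<dots> = (B div X) * (\<Sum>t<A div X * X. gcd t X)"
    using X by (simp add: sum_distrib_left)
  finally show ?thesis unfolding sum_gcd_periods by simp
qed

lemma solutions_homogeneous_congruence:
  assumes "a > 0"
  shows "{s \<in> {0..<int a}. int a dvd int k * s} = (\<lambda>t. int (a div gcd a k) * t) ` {0..<int (gcd a k)}"
proof -
  define g where "g = gcd a k"
  define a' where "a' = a div g"
  have g: "g > 0" "a = a' * g" "a' > 0" using assms by (auto simp: g_def a'_def div_greater_zero_iff)
  have iff: "int a dvd int k * s \<longleftrightarrow> int a' dvd s" for s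
    using dvd_mult_iff_div_gcd_dvd[of "int a" "int k" s] assms
    by (simp add: a'_def g_def gcd.commute zdiv_int)
  have scale: "int a' * t \<in> {0..<int a} \<longleftrightarrow> t \<in> {0..<int g}" for t
  proof -
    have "int a = int a' * int g" using g(2) by simp
    then show ?thesis using g(3) by (simp add: zero_le_mult_iff)
  qed
  have "{s \<in> {0..<int a}. int a' dvd s} = (\<lambda>t. int a' * t) ` {0..<int g}"
  proof (intro subset_antisym subsetI)
    fix s assume s: "s \<in> {s \<in> {0..<int a}. int a' dvd s}"
    then obtain t where t: "s = int a' * t" unfolding dvd_def by blast
    with s have "t \<in> {0..<int g}" using scale by blast
    with t show "s \<in> (\<lambda>t. int a' * t) ` {0..<int g}" by blast
  next
    fix s assume "s \<in> (\<lambda>t. int a' * t) ` {0..<int g}"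
    then obtain t where t: "s = int a' * t" "t \<in> {0..<int g}" by blast
    then have "int a' dvd s" "s \<in> {0..<int a}" using scale by (simp, blast)
    then show "s \<in> {s \<in> {0..<int a}. int a' dvd s}" by blast
  qed
  then show ?thesis unfolding iff by (simp add: a'_def g_def)
qed

section \<open>Counting Hermite normal forms\<close>

text \<open>
The count of the off-diagonal entries: $s = (a/A) t$ and $v = (b/B) w$ range over arithmetic
progressions, and the congruence for $u$ has $C$ solutions when $X \mid t w$ and none otherwise.
The divisibilities $X \mid A$ and $X \mid B$, which make the pairs $(t, w)$ countable by periods,
amount to $BC \mid a (r/c)$ and $AC \mid a (r/c)$.
\<close>

lemma card_hnf_entries:
  fixes n r a b c :: nat
  assumes pos: "a > 0" "b > 0"
  defines "A \<equiv> gcd a (n div b)" and "B \<equiv> gcd b (r div c)" and "C \<equiv> gcd a (r div c)"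
  defines "X \<equiv> (A * B * C) div gcd (a * (r div c)) (A * B * C)"
  shows "card (hnf_entries n r (a, b, c)) = C * ((A div X) * (B div X) * gcd_sum X)"
    and "X > 0" "X dvd A" "X dvd B"
proof -
  define k q where "k = n div b" and "q = r div c"
  have ABC: "A > 0" "B > 0" "C > 0" using pos by (auto simp: A_def B_def C_def)
  define G where "G = gcd (a * q) (A * B * C)"
  have G: "X * G = A * B * C" by (simp add: X_def G_def q_def)
  then show X: "X > 0" using ABC by (metis mult_pos_pos neq0_conv mult_0)
  have G0: "G > 0" using G ABC by (metis mult_pos_pos neq0_conv mult_0_right)
  have "B * C dvd a * q" "A * C dvd a * q"
    using mult_dvd_mono[of C a B q] mult_dvd_mono[of A a C q]
    by (auto simp: A_def B_def C_def q_def mult.commute)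
  then have *: "B * C dvd G" "A * C dvd G"
    by (auto simp: G_def mult.assoc mult.left_commute intro!: dvd_mult)
  have "X * (B * C) dvd A * (B * C)" using mult_dvd_mono[OF dvd_refl *(1), of X] G by (simp add: mult.assoc)
  then show XA: "X dvd A" using ABC by simp
  have "X * (A * C) dvd B * (A * C)" using mult_dvd_mono[OF dvd_refl *(2), of X] G by (metis mult.assoc mult.left_commute)
  then show XB: "X dvd B" using ABC by simp

  define a' b' q' where "a' = a div A" and "b' = b div B" and "q' = q div B"
  have a': "a = a' * A" and b': "b = b' * B" and q': "q = q' * B"
    by (auto simp: a'_def b'_def q'_def A_def B_def q_def)
  have pos': "a' > 0" "b' > 0" using pos a' b' by (metis mult_0 neq0_conv)+
  have S: "{s \<in> {0..<int a}. int a dvd int k * s} = (\<lambda>t. int a' * t) ` {0..<int A}"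
    using solutions_homogeneous_congruence[OF pos(1), of k] by (simp add: A_def a'_def k_def)
  have V: "{v \<in> {0..<int b}. int b dvd int q * v} = (\<lambda>w. int b' * w) ` {0..<int B}"
    using solutions_homogeneous_congruence[OF pos(2), of q] by (simp add: B_def b'_def q_def)
  \<comment> \<open>The divisor \<open>b\<close> cancels, so the coefficient of \<open>s\<close> in the condition on \<open>u\<close> is linear in \<open>w\<close>.\<close>
  have quot: "(int q * (int b' * w)) div int b = int q' * w" for w
    using pos' ABC unfolding b' q' by (simp add: mult_ac)
  define U where "U = (\<lambda>(t, w). {u \<in> {0..<int a}. int a dvd int q * u - int q' * w * (int a' * t)})"
  let ?T = "{0..<int A} \<times> {0..<int B}"
  have cardU: "card (U (t, w)) = (if int X dvd t * w then C else 0)" for t w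
  proof -
    have "card (U (t, w)) = (if int C dvd int q' * w * (int a' * t) then C else 0)"
      using card_linear_congruence[OF pos(1), of 1 "int q" "int q' * w * (int a' * t)"]
      by (simp add: U_def C_def q_def gcd.commute)
    \<comment> \<open>Multiplying by \<open>A * B\<close> restores \<open>a\<close> and \<open>q\<close> from their cofactors.\<close>
    also have "int C dvd int q' * w * (int a' * t) \<longleftrightarrow>
        int (A * B) * int C dvd int (A * B) * (int q' * w * (int a' * t))"
      using ABC by simp
    also have "int (A * B) * (int q' * w * (int a' * t)) = int (a * q) * (t * w)"
      by (simp add: a' q' mult_ac)
    also have "int (A * B) * int C dvd int (a * q) * (t * w) \<longleftrightarrow>
        int (A * B * C) div gcd (int (a * q)) (int (A * B * C)) dvd t * w"
      using ABC by (subst dvd_mult_iff_div_gcd_dvd[symmetric]) auto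
    also have "int (A * B * C) div gcd (int (a * q)) (int (A * B * C)) = int X"
      by (simp only: X_def q_def gcd_int_int_eq zdiv_int)
    finally show ?thesis .
  qed
  have "bij_betw (\<lambda>((t, w), u). (int a' * t, u, int b' * w)) (Sigma ?T U) (hnf_entries n r (a, b, c))"
    unfolding bij_betw_def
  proof
    show "inj_on (\<lambda>((t, w), u). (int a' * t, u, int b' * w)) (Sigma ?T U)"
      using pos' by (auto simp: inj_on_def)
    show "(\<lambda>((t, w), u). (int a' * t, u, int b' * w)) ` Sigma ?T U = hnf_entries n r (a, b, c)"
    proof (intro subset_antisym subsetI)
      fix e assume "e \<in> (\<lambda>((t, w), u). (int a' * t, u, int b' * w)) ` Sigma ?T U"
      then obtain p where p: "p \<in> Sigma ?T U" "e = (\<lambda>((t, w), u). (int a' * t, u, int b' * w)) p"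
        by blast
      moreover obtain t w u where "p = ((t, w), u)" by (metis surj_pair)
      ultimately have e: "e = (int a' * t, u, int b' * w)"
        and t: "t \<in> {0..<int A}" and w: "w \<in> {0..<int B}" and u: "u \<in> U (t, w)" by auto
      have "int a' * t \<in> {s \<in> {0..<int a}. int a dvd int k * s}" using t unfolding S by blast
      moreover have "int b' * w \<in> {v \<in> {0..<int b}. int b dvd int q * v}" using w unfolding V by blast
      ultimately show "e \<in> hnf_entries n r (a, b, c)"
        using u by (simp add: e hnf_entries_def U_def quot flip: k_def q_def)
    next
      fix e assume "e \<in> hnf_entries n r (a, b, c)"
      then obtain s u v where e: "e = (s, u, v)"
        and s: "s \<in> {s \<in> {0..<int a}. int a dvd int k * s}"
        and v: "v \<in> {v \<in> {0..<int b}. int b dvd int q * v}"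
        and u: "u \<in> {0..<int a}" "int a dvd int q * u - (int q * v div int b) * s"
        by (auto simp: hnf_entries_def k_def q_def)
      obtain t where t: "t \<in> {0..<int A}" "s = int a' * t" using s unfolding S by blast
      obtain w where w: "w \<in> {0..<int B}" "v = int b' * w" using v unfolding V by blast
      have "u \<in> U (t, w)" using u by (simp add: U_def t w quot)
      then show "e \<in> (\<lambda>((t, w), u). (int a' * t, u, int b' * w)) ` Sigma ?T U"
        using t w e by force
    qed
  qed
  then have "card (hnf_entries n r (a, b, c)) = card (Sigma ?T U)"
    by (simp add: bij_betw_same_card)
  also have "\<dots> = (\<Sum>p\<in>?T. card (U p))" by (rule card_SigmaI) (auto simp: U_def finite_bounded_ints simp del: atLeastLessThan_iff)
  also have "\<dots> = (\<Sum>(t, w)\<in>?T. if int X dvd t * w then C else 0)"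
    by (intro sum.cong) (auto simp: cardU)
  also have "\<dots> = (\<Sum>p\<in>{p \<in> ?T. int X dvd fst p * snd p}. C)"
    by (subst sum.inter_filter) (auto simp: case_prod_unfold)
  also have "\<dots> = C * card {(t, w). t \<in> {0..<int A} \<and> w \<in> {0..<int B} \<and> int X dvd t * w}"
  proof -
    have "{p \<in> ?T. int X dvd fst p * snd p}
        = {(t, w). t \<in> {0..<int A} \<and> w \<in> {0..<int B} \<and> int X dvd t * w}" by auto
    then show ?thesis by (simp add: mult.commute)
  qed
  also have "\<dots> = C * ((A div X) * (B div X) * gcd_sum X)"
    by (simp only: card_product_divisible[OF X XA XB])
  finally show "card (hnf_entries n r (a, b, c)) = C * ((A div X) * (B div X) * gcd_sum X)" .
qed

lemma card_hnf_entries_summand: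
  assumes "a > 0" "b > 0"
  shows "of_nat (card (hnf_entries n r (a, b, c))) = summand n r a b c"
proof -
  define A B C where "A = gcd a (n div b)" and "B = gcd b (r div c)" and "C = gcd a (r div c)"
  define X where "X = (A * B * C) div gcd (a * (r div c)) (A * B * C)"
  note entries = card_hnf_entries[OF assms, of n r c, folded A_def B_def C_def, folded X_def]
  have "(of_nat X :: rat) \<noteq> 0" using entries(2) by simp
  moreover from entries(3,4) obtain A' B' where "A = X * A'" "B = X * B'" by (auto elim!: dvdE)
  ultimately have "of_nat (C * ((A div X) * (B div X) * gcd_sum X))
      = (of_nat (A * B * C) / (of_nat X)\<^sup>2 * of_nat (gcd_sum X) :: rat)"
    by (simp add: field_simps power2_eq_square)
  then show ?thesis
    by (simp add: entries(1) summand_def Let_def flip: A_def B_def C_def X_def)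
qed

text \<open>
By back substitution, $z$ runs through one residue class modulo $c$, for given $z$ the second
coordinate runs through one residue class modulo $b$, and for given $y$ and $z$ the first runs
through one residue class modulo $a$. As the box consists of whole periods, the number of points
is $(r/c)(n/b)(m/a)$.
\<close>

lemma card_hnf_lattice_box:
  assumes "(a, b, c) \<in> divisor_triples m n r" and pos: "m > 0" "n > 0" "r > 0"
  shows "card (hnf_lattice ((a, b, c), (s, u, v)) \<inter> carrier (Z3 m n r)) * (a * b * c) = m * n * r"
proof -
  have abc: "a > 0" "b > 0" "c > 0" "a dvd m" "b dvd n" "c dvd r"
    using assms by (auto simp: divisor_triples_def intro: dvd_pos_nat)
  define f where "f = (\<lambda>z. (z div int c) * v)"
  define g where "g = (\<lambda>z y. (z div int c) * u + ((y - f z) div int b) * s)"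
  define Z where "Z = {z \<in> {0..<int r}. int c dvd z - 0}"
  define Y where "Y = (\<lambda>z. {y \<in> {0..<int n}. int b dvd y - f z})"
  define W where "W = (\<lambda>z y. {x \<in> {0..<int m}. int a dvd x - g z y})"
  have cards: "card Z = r div c" "card (Y z) = n div b" "card (W z y) = m div a" for z y
    using card_residue_class[of c "r div c" 0] card_residue_class[of b "n div b" "f z"]
      card_residue_class[of a "m div a" "g z y"] abc
    by (simp_all add: Z_def Y_def W_def)
  have fin: "finite Z" "finite (Y z)" "finite (W z y)" for z y
    unfolding Z_def Y_def W_def by (rule finite_bounded_ints)+
  have "hnf_lattice ((a, b, c), (s, u, v)) \<inter> carrier (Z3 m n r)
      = (\<lambda>(z, y, x). (x, y, z)) ` (SIGMA z:Z. SIGMA y:Y z. W z y)"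
    unfolding carrier_Z3[OF pos]
    by (auto simp: hnf_lattice_iff[OF abc(1-3)] Z_def Y_def W_def f_def g_def image_iff
        diff_diff_eq)
  moreover have "inj_on (\<lambda>(z, y, x). (x, y, z)) (SIGMA z:Z. SIGMA y:Y z. W z y)"
    by (auto simp: inj_on_def)
  ultimately have "card (hnf_lattice ((a, b, c), (s, u, v)) \<inter> carrier (Z3 m n r))
      = card (SIGMA z:Z. SIGMA y:Y z. W z y)"
    by (simp add: card_image)
  also have "\<dots> = (r div c) * ((n div b) * (m div a))"
    by (simp add: card_SigmaI fin cards finite_SigmaI)
  finally show ?thesis using abc by (auto elim!: dvdE)
qed

section \<open>The number of subgroups\<close>

theorem theorem2p2:
  fixes m n r :: nat
  assumes "m \<ge> 1" and "n \<ge> 1" and "r \<ge> 1"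
  shows "of_nat (num_subgroups m n r) =
           (\<Sum>(a, b, c) \<in> {(a, b, c). a dvd m \<and> b dvd n \<and> c dvd r}. summand n r a b c)
       \<and> (\<forall>\<delta>::nat. \<delta> \<ge> 1 \<longrightarrow> \<delta> dvd m * n * r \<longrightarrow>
            of_nat (num_subgroups_of_order m n r \<delta>) =
              (\<Sum>(a, b, c) \<in> {(a, b, c). a dvd m \<and> b dvd n \<and> c dvd r
                                         \<and> a * b * c = (m * n * r) div \<delta>}. summand n r a b c))"
proof -
  have pos: "m > 0" "n > 0" "r > 0" using assms by auto
  let ?D = "divisor_triples m n r" and ?E = "hnf_entries n r"
  define F where "F t = hnf_lattice t \<inter> carrier (Z3 m n r)" for t
  have bij: "bij_betw F (Sigma ?D ?E) {H. subgroup H (Z3 m n r)}"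
    using bij_betw_trans[OF bij_betw_hnf_lattices[OF pos] bij_betw_lattices_subgroups[OF pos]]
    by (simp add: F_def[abs_def] o_def)
  have finD: "finite ?D"
    by (rule finite_subset[of _ "{d. d dvd m} \<times> {d. d dvd n} \<times> {d. d dvd r}"])
       (use pos in \<open>auto simp: divisor_triples_def\<close>)
  have count: "of_nat (card (F ` Sigma D ?E)) = (\<Sum>(a, b, c)\<in>D. summand n r a b c)"
    if D: "D \<subseteq> ?D" for D
  proof -
    have "inj_on F (Sigma D ?E)"
      using bij_betw_imp_inj_on[OF bij] by (rule inj_on_subset) (use D in auto)
    then have "card (F ` Sigma D ?E) = card (Sigma D ?E)" by (rule card_image)
    also have "\<dots> = (\<Sum>p\<in>D. card (?E p))"
    proof (rule card_SigmaI)
      show "finite D" using finD D finite_subset by blast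
      show "\<forall>p\<in>D. finite (?E p)"
      proof
        fix p :: "nat \<times> nat \<times> nat"
        obtain a b c where p: "p = (a, b, c)" by (cases p)
        show "finite (?E p)"
          by (rule finite_subset[of _ "{0..<int a} \<times> {0..<int a} \<times> {0..<int b}"])
             (auto simp: p hnf_entries_def)
      qed
    qed
    finally have "of_nat (card (F ` Sigma D ?E)) = (\<Sum>p\<in>D. of_nat (card (?E p)) :: rat)"
      by simp
    also have "\<dots> = (\<Sum>(a, b, c)\<in>D. summand n r a b c)"
    proof (intro sum.cong refl)
      fix p assume "p \<in> D"
      moreover obtain a b c where "p = (a, b, c)" by (cases p)
      moreover have "a > 0" "b > 0" if "(a, b, c) \<in> ?D"
        using that pos by (auto simp: divisor_triples_def intro: dvd_pos_nat)
      ultimately show "of_nat (card (?E p)) = (case p of (a, b, c) \<Rightarrow> summand n r a b c)"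
        using card_hnf_entries_summand D by auto
    qed
    finally show ?thesis .
  qed
  have "of_nat (num_subgroups m n r) = (\<Sum>(a, b, c)\<in>?D. summand n r a b c)"
    using count[of ?D] bij_betw_imp_surj_on[OF bij] by (simp add: num_subgroups_def)
  moreover have "of_nat (num_subgroups_of_order m n r \<delta>) =
      (\<Sum>(a, b, c) \<in> {(a, b, c). a dvd m \<and> b dvd n \<and> c dvd r
                                 \<and> a * b * c = (m * n * r) div \<delta>}. summand n r a b c)"
    if \<delta>: "\<delta> \<ge> 1" "\<delta> dvd m * n * r" for \<delta>
  proof -
    define D' where "D' = {(a, b, c). a dvd m \<and> b dvd n \<and> c dvd r \<and> a * b * c = (m * n * r) div \<delta>}"
    have D': "D' \<subseteq> ?D" by (auto simp: D'_def divisor_triples_def)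
    have order: "card (F t) = \<delta> \<longleftrightarrow> fst t \<in> D'" if t: "t \<in> Sigma ?D ?E" for t
    proof -
      obtain a b c s u v where t': "t = ((a, b, c), (s, u, v))" by (metis prod_cases3 surj_pair)
      have abc: "(a, b, c) \<in> ?D" using t t' by auto
      then have "a > 0 \<and> b > 0 \<and> c > 0"
        using pos by (auto simp: divisor_triples_def intro: dvd_pos_nat)
      moreover have "card (F t) * (a * b * c) = \<delta> * ((m * n * r) div \<delta>)"
        using card_hnf_lattice_box[OF abc pos] dvd_mult_div_cancel[OF \<delta>(2)]
        by (simp only: F_def t')
      ultimately have "card (F t) = \<delta> \<longleftrightarrow> a * b * c = (m * n * r) div \<delta>"
        using \<delta>(1) by (auto simp only: mult_cancel1 mult_cancel2 mult_eq_0_iff)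
      then show ?thesis using abc by (auto simp: t' D'_def divisor_triples_def)
    qed
    have "{H. subgroup H (Z3 m n r) \<and> card H = \<delta>} = {H \<in> F ` Sigma ?D ?E. card H = \<delta>}"
      by (simp only: bij_betw_imp_surj_on[OF bij] mem_Collect_eq)
    also have "\<dots> = F ` {t \<in> Sigma ?D ?E. card (F t) = \<delta>}"
      by (rule Compr_image_eq)
    also have "{t \<in> Sigma ?D ?E. card (F t) = \<delta>} = {t \<in> Sigma ?D ?E. fst t \<in> D'}"
      by (rule Collect_cong) (rule conj_cong[OF refl order])
    also have "\<dots> = Sigma D' ?E" using D' by auto
    finally show ?thesis using count[OF D'] by (simp add: num_subgroups_of_order_def D'_def)
  qed
  ultimately show ?thesis by (simp add: divisor_triples_def)
qed

end
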